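(* Let $\mathcal{C}\subseteq\mathbb{R}^n$ be a full-dimensional pointed polyhedral cone with extreme rays $R_i=\mathbb{R}_+v_i$, $1\le i\le p$. (i) If $\alpha=(\alpha_1,\dots,\alpha_p)$ and $\alpha'=(\alpha'_1,\dots,\alpha'_p)$ are two vectors of positive reals with $\mathrm{Part}(\alpha)=\mathrm{Part}(\alpha')$, then $\mathrm{Lin}_{\alpha v}(\mathcal{C})=\mathrm{Lin}_{\alpha' v}(\mathcal{C})$. (ii) If $\alpha$ is a vector of positive reals such that $\mathrm{Lin}_{\alpha v}(\mathcal{C})$ is transitive on $\{1,\dots,p\}$, then $\mathrm{Lin}_{\alpha v}(\mathcal{C})=\mathrm{Proj}(\mathcal{C})$.
   Context: A polyhedral cone is the set of vectors satisfying finitely many homogeneous linear inequalities; it is assumed full-dimensional and containing no nontrivial linear subspace, hence generated by its extreme rays. For generators $u=\{u_1,\dots,u_p\}$ of the extreme rays, $\mathrm{Lin}_u(\mathcal{C})$ is the group of $\sigma\in\mathrm{Sym}(p)$ such that some $A\in\mathrm{GL}_n(\mathbb{R})$ satisfies $Au_i=u_{\sigma(i)}$ for all $i$. For positive reals $\alpha_i$, $\alpha v$ denotes the generator set $\{\alpha_1v_1,\dots,\alpha_pv_p\}$, and $\mathrm{Part}(\alpha)$ denotes the partition of $\{1,\dots,p\}$ into orbits of the permutation group $\mathrm{Lin}_{\alpha v}(\mathcal{C})$. $\mathrm{Proj}(\mathcal{C})$ is the group of $\sigma\in\mathrm{Sym}(p)$ such that some $A\in\mathrm{GL}_n(\mathbb{R})$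 with $A\mathcal{C}=\mathcal{C}$ satisfies $AR_i=R_{\sigma(i)}$ for all $i$. *)

theory Defs
  imports "HOL-Analysis.Analysis" "HOL-Algebra.Group_Action" "HOL-Algebra.Sym_Groups"
begin

definition polyhedral_cone :: "(real ^ 'n) set \<Rightarrow> bool" where
  "polyhedral_cone C \<longleftrightarrow> (\<exists>F. finite F \<and> C = {x. \<forall>a\<in>F. 0 \<le> a \<bullet> x})"

definition full_dimensional :: "(real ^ 'n) set \<Rightarrow> bool" where
  "full_dimensional C \<longleftrightarrow> aff_dim C = int CARD('n)"

definition pointed :: "(real ^ 'n) set \<Rightarrow> bool" where
  "pointed C \<longleftrightarrow> (\<forall>S. subspace S \<and> S \<subseteq> C \<longrightarrow> S = {0})"

definition ray :: "real ^ 'n \<Rightarrow> (real ^ 'n) set" where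
  "ray v = {c *\<^sub>R v | c. 0 \<le> c}"

text \<open>For a pointed cone the one-dimensional faces are exactly its extreme rays, each
  including the origin.\<close>

definition extreme_rays :: "(real ^ 'n) set \<Rightarrow> (real ^ 'n) set set" where
  "extreme_rays C = {R. R face_of C \<and> aff_dim R = 1}"

text \<open>The generators are indexed by \<open>1, \<dots>, p\<close>; values of \<open>u\<close>, \<open>v\<close>, \<open>\<alpha>\<close>
  at other indices are irrelevant below.\<close>

definition lin_group :: "nat \<Rightarrow> (nat \<Rightarrow> real ^ 'n) \<Rightarrow> (nat \<Rightarrow> nat) monoid" where
  "lin_group p u = (sym_group p)\<lparr>carrier := {\<sigma> \<in> carrier (sym_group p).
     \<exists>A :: real ^ 'n ^ 'n. invertible A \<and> (\<forall>i\<in>{1..p}. A *v u i = u (\<sigma> i))}\<rparr>"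

definition proj_group :: "nat \<Rightarrow> (real ^ 'n) set \<Rightarrow> (nat \<Rightarrow> (real ^ 'n) set) \<Rightarrow> (nat \<Rightarrow> nat) monoid" where
  "proj_group p C R = (sym_group p)\<lparr>carrier := {\<sigma> \<in> carrier (sym_group p).
     \<exists>A :: real ^ 'n ^ 'n. invertible A \<and> (*v) A ` C = C \<and>
       (\<forall>i\<in>{1..p}. (*v) A ` R i = R (\<sigma> i))}\<rparr>"

definition scaled :: "(nat \<Rightarrow> real) \<Rightarrow> (nat \<Rightarrow> real ^ 'n) \<Rightarrow> nat \<Rightarrow> real ^ 'n" where
  "scaled \<alpha> v = (\<lambda>i. \<alpha> i *\<^sub>R v i)"

definition orbit_partition :: "nat \<Rightarrow> (nat \<Rightarrow> nat) monoid \<Rightarrow> nat set set" where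
  "orbit_partition p G = orbits G {1..p} (\<lambda>\<sigma>. \<sigma>)"

definition transitive_on_indices :: "nat \<Rightarrow> (nat \<Rightarrow> nat) monoid \<Rightarrow> bool" where
  "transitive_on_indices p G \<longleftrightarrow> (\<forall>i\<in>{1..p}. \<forall>j\<in>{1..p}. \<exists>\<sigma>\<in>carrier G. \<sigma> i = j)"

lemma sym_subgroup_criterion:
  assumes "H \<subseteq> carrier (sym_group p)" "id \<in> H"
    and "\<And>\<sigma> \<tau>. \<lbrakk>\<sigma> \<in> H; \<tau> \<in> H\<rbrakk> \<Longrightarrow> \<sigma> \<circ> \<tau> \<in> H"
    and "\<And>\<sigma>. \<sigma> \<in> H \<Longrightarrow> inv' \<sigma> \<in> H"
  shows "group ((sym_group p)\<lparr>carrier := H\<rparr>)"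
proof -
  have "subgroup H (sym_group p)"
  proof (rule group.subgroupI[OF sym_group_is_group])
    fix \<sigma> assume "\<sigma> \<in> H"
    then show "inv\<^bsub>sym_group p\<^esub> \<sigma> \<in> H"
      using assms(1,4) by (metis subsetD sym_group_inv_equality)
  qed (use assms in \<open>auto simp: sym_group_mult\<close>)
  then show ?thesis
    by (rule subgroup.subgroup_is_group[OF _ sym_group_is_group])
qed

lemma permutes_index: "\<lbrakk>\<sigma> permutes {1..p::nat}; i \<in> {1..p}\<rbrakk> \<Longrightarrow> \<sigma> i \<in> {1..p}"
  by (simp only: permutes_in_image)

lemma group_lin_group: "group (lin_group p u)"
  unfolding lin_group_def
proof (rule sym_subgroup_criterion, goal_cases)
  case 1 show ?case by blast
next
  case 2
  have "invertible (mat 1 :: real ^ 'a ^ 'a)" by (metis invertible_def matrix_mul_lid)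
  then show ?case
    by (auto simp: sym_group_carrier permutes_id[unfolded id_def] id_def intro!: exI[of _ "mat 1"])
next
  case (3 \<sigma> \<tau>)
  then obtain A B :: "real ^ 'a ^ 'a" where
    A: "invertible A" "\<forall>i\<in>{1..p}. A *v u i = u (\<sigma> i)" and
    B: "invertible B" "\<forall>i\<in>{1..p}. B *v u i = u (\<tau> i)" by auto
  have p: "\<sigma> permutes {1..p}" "\<tau> permutes {1..p}" using 3 by (auto simp: sym_group_carrier)
  have "\<forall>i\<in>{1..p}. (A ** B) *v u i = u ((\<sigma> \<circ> \<tau>) i)"
    using A B permutes_index[OF p(2)] by (auto simp flip: matrix_vector_mul_assoc)
  then show ?case
    using invertible_mult[OF A(1) B(1)] permutes_compose[OF p(2) p(1)]
    by (auto simp: sym_group_carrier)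
next
  case (4 \<sigma>)
  then obtain A :: "real ^ 'a ^ 'a" where
    A: "invertible A" "\<forall>i\<in>{1..p}. A *v u i = u (\<sigma> i)" by auto
  have p: "\<sigma> permutes {1..p}" using 4 by (auto simp: sym_group_carrier)
  from A(1) obtain B where B: "A ** B = mat 1" "B ** A = mat 1" by (auto simp: invertible_def)
  have "B *v u i = u (inv' \<sigma> i)" if "i \<in> {1..p}" for i
  proof -
    have "inv' \<sigma> i \<in> {1..p}" using permutes_index[OF permutes_inv[OF p] that] .
    then have "A *v u (inv' \<sigma> i) = u i" using A(2) permutes_inverses(1)[OF p] by simp
    then show ?thesis by (metis B(2) matrix_vector_mul_assoc matrix_vector_mul_lid)
  qed
  moreover have "invertible B" using B by (auto simp: invertible_def)
  ultimately show ?case using permutes_inv[OF p] by (auto simp: sym_group_carrier)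
qed

lemma group_proj_group: "group (proj_group p C R)"
  unfolding proj_group_def
proof (rule sym_subgroup_criterion, goal_cases)
  case 1 show ?case by blast
next
  case 2
  have "invertible (mat 1 :: real ^ 'a ^ 'a)" by (metis invertible_def matrix_mul_lid)
  then show ?case
    by (auto simp: sym_group_carrier permutes_id[unfolded id_def] id_def intro!: exI[of _ "mat 1"])
next
  case (3 \<sigma> \<tau>)
  then obtain A B :: "real ^ 'a ^ 'a" where
    A: "invertible A" "(*v) A ` C = C" "\<forall>i\<in>{1..p}. (*v) A ` R i = R (\<sigma> i)" and
    B: "invertible B" "(*v) B ` C = C" "\<forall>i\<in>{1..p}. (*v) B ` R i = R (\<tau> i)" by auto
  have p: "\<sigma> permutes {1..p}" "\<tau> permutes {1..p}" using 3 by (auto simp: sym_group_carrier)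
  have im: "(*v) (A ** B) ` S = (*v) A ` ((*v) B ` S)" for S
    by (simp add: image_image matrix_vector_mul_assoc)
  have "\<forall>i\<in>{1..p}. (*v) (A ** B) ` R i = R ((\<sigma> \<circ> \<tau>) i)" "(*v) (A ** B) ` C = C"
    using A B permutes_index[OF p(2)] unfolding im by auto
  then show ?case
    using invertible_mult[OF A(1) B(1)] permutes_compose[OF p(2) p(1)]
    by (auto simp: sym_group_carrier)
next
  case (4 \<sigma>)
  then obtain A :: "real ^ 'a ^ 'a" where
    A: "invertible A" "(*v) A ` C = C" "\<forall>i\<in>{1..p}. (*v) A ` R i = R (\<sigma> i)" by auto
  have p: "\<sigma> permutes {1..p}" using 4 by (auto simp: sym_group_carrier)
  from A(1) obtain B where B: "A ** B = mat 1" "B ** A = mat 1" by (auto simp: invertible_def)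
  have BA: "(*v) B ` ((*v) A ` S) = S" for S
    by (simp add: image_image matrix_vector_mul_assoc B)
  have "(*v) B ` R i = R (inv' \<sigma> i)" if "i \<in> {1..p}" for i
  proof -
    have "inv' \<sigma> i \<in> {1..p}" using permutes_index[OF permutes_inv[OF p] that] .
    then have "(*v) A ` R (inv' \<sigma> i) = R i" using A(3) permutes_inverses(1)[OF p] by simp
    then show ?thesis by (metis BA)
  qed
  moreover have "(*v) B ` C = C" by (metis A(2) BA)
  moreover have "invertible B" using B by (auto simp: invertible_def)
  ultimately have "invertible B \<and> (*v) B ` C = C \<and> (\<forall>i\<in>{1..p}. (*v) B ` R i = R (inv' \<sigma> i))"
    by blast
  then show ?case using permutes_inv[OF p] unfolding mem_Collect_eq sym_group_carrier by blast
qed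

end

theory Submission
  imports Defs
begin

text \<open>
  Write \<open>A v\<^sub>i = exp (x\<^sub>i) v\<^bsub>\<sigma> i\<^esub>\<close> for a linear map inducing \<open>\<sigma>\<close> on the rays. The eigenvalue
  vectors of maps fixing every ray form a subalgebra of \<open>\<real>\<^sup>p\<close>, hence are the vectors constant on the
  classes of an equivalence relation, and \<open>x\<close> is determined by \<open>\<sigma>\<close> up to such vectors. Choosing the
  \<open>x\<close> with zero mean on every class gives a cocycle of the finite group \<open>Proj\<close>; averaging shows that
  it is a coboundary, so some rescaling \<open>exp g\<close> of the generators is permuted by all of \<open>Proj\<close>.
  Relative to this rescaling, \<open>Lin\<close> of \<open>\<alpha> v\<close> is the stabiliser in \<open>Proj\<close> of the vector \<open>w\<close> obtained
  from \<open>ln \<alpha> - g\<close> by subtracting class means. Thus \<open>Lin\<close> consists of the elements of \<open>Proj\<close> that preserve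
  a vector constant on its own orbits, which yields both claims.
\<close>

section \<open>Permutations of a spanning family induced by linear maps\<close>

locale spanning_family =
  fixes I :: "'i set" and v :: "'i \<Rightarrow> real ^ 'n"
  assumes finite_index: "finite I"
    and spanning: "span (v ` I) = UNIV"
begin

text \<open>\<open>A\<close> may be singular, so that sums and products of eigenvalue vectors are
  again eigenvalue vectors. Values off \<open>I\<close> are unconstrained.\<close>

definition eigenfuns :: "('i \<Rightarrow> real) set" where
  "eigenfuns = {l. \<exists>A :: real ^ 'n ^ 'n. \<forall>i\<in>I. A *v v i = l i *\<^sub>R v i}"

text \<open>The classes on \<open>I\<close> describe the finest splitting of the space into a direct
  sum of spans of generators: a map may be scaled independently on each summand, and only
  there.\<close>

definition linked :: "'i \<Rightarrow> 'i \<Rightarrow> bool" where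
  "linked i j \<longleftrightarrow> (\<forall>l\<in>eigenfuns. l i = l j)"

definition linked_class :: "'i \<Rightarrow> 'i set" where
  "linked_class i = {j\<in>I. linked i j}"

definition class_constant :: "('i \<Rightarrow> real) \<Rightarrow> bool" where
  "class_constant x \<longleftrightarrow> (\<forall>i\<in>I. \<forall>j\<in>I. linked i j \<longrightarrow> x i = x j)"

definition class_mean :: "('i \<Rightarrow> real) \<Rightarrow> 'i \<Rightarrow> real" where
  "class_mean x i = (\<Sum>j\<in>linked_class i. x j) / real (card (linked_class i))"

text \<open>Writing the positive factors as exponentials makes composition additive in
  \<open>x\<close>, so scaling vectors can be averaged.\<close>

definition acts :: "('i \<Rightarrow> 'i) \<Rightarrow> ('i \<Rightarrow> real) \<Rightarrow> bool" where
  "acts \<sigma> x \<longleftrightarrow> (\<exists>A :: real ^ 'n ^ 'n. \<forall>i\<in>I. A *v v i = exp (x i) *\<^sub>R v (\<sigma> i))"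

text \<open>No cone is mentioned; for the generators of a pointed cone this set is the carrier of
  Proj, see \<open>carrier_proj_group\<close>.\<close>

definition proj_perms :: "('i \<Rightarrow> 'i) set" where
  "proj_perms = {\<sigma>. \<sigma> permutes I \<and> (\<exists>x. acts \<sigma> x)}"

lemma linked_refl: "linked i i" and linked_sym: "linked i j \<Longrightarrow> linked j i"
  and linked_trans: "linked i j \<Longrightarrow> linked j k \<Longrightarrow> linked i k"
  by (auto simp: linked_def)

section \<open>The algebra of simultaneous eigenvalue vectors\<close>

lemma eigenfuns_const: "(\<lambda>_. c) \<in> eigenfuns"
  unfolding eigenfuns_def
  by (auto intro!: exI[of _ "c *\<^sub>R mat 1"] simp: scaleR_matrix_vector_assoc[symmetric])

lemma eigenfuns_add:
  assumes "l \<in> eigenfuns" "m \<in> eigenfuns"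
  shows "(\<lambda>i. l i + m i) \<in> eigenfuns"
proof -
  from assms obtain A B :: "real ^ 'n ^ 'n" where
    "\<forall>i\<in>I. A *v v i = l i *\<^sub>R v i" "\<forall>i\<in>I. B *v v i = m i *\<^sub>R v i"
    by (auto simp: eigenfuns_def)
  then have "\<forall>i\<in>I. (A + B) *v v i = (l i + m i) *\<^sub>R v i"
    by (simp add: matrix_vector_mult_add_rdistrib scaleR_left_distrib)
  then show ?thesis by (auto simp: eigenfuns_def)
qed

lemma eigenfuns_mult:
  assumes "l \<in> eigenfuns" "m \<in> eigenfuns"
  shows "(\<lambda>i. l i * m i) \<in> eigenfuns"
proof -
  from assms obtain A B :: "real ^ 'n ^ 'n" where
    "\<forall>i\<in>I. A *v v i = l i *\<^sub>R v i" "\<forall>i\<in>I. B *v v i = m i *\<^sub>R v i"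
    by (auto simp: eigenfuns_def)
  then have "\<forall>i\<in>I. (A ** B) *v v i = (l i * m i) *\<^sub>R v i"
    by (simp add: matrix_vector_mul_assoc[symmetric] matrix_vector_mult_scaleR mult.commute)
  then show ?thesis by (auto simp: eigenfuns_def)
qed

lemma eigenfuns_cong:
  assumes "l \<in> eigenfuns" "\<And>i. i \<in> I \<Longrightarrow> l i = m i"
  shows "m \<in> eigenfuns"
  using assms by (auto simp: eigenfuns_def)

lemma eigenfuns_sum:
  "finite K \<Longrightarrow> (\<And>k. k \<in> K \<Longrightarrow> f k \<in> eigenfuns) \<Longrightarrow> (\<lambda>i. \<Sum>k\<in>K. f k i) \<in> eigenfuns"
  by (induction K rule: finite_induct) (auto simp: eigenfuns_const intro!: eigenfuns_add)

lemma eigenfuns_prod: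
  "finite K \<Longrightarrow> (\<And>k. k \<in> K \<Longrightarrow> f k \<in> eigenfuns) \<Longrightarrow> (\<lambda>i. \<Prod>k\<in>K. f k i) \<in> eigenfuns"
  by (induction K rule: finite_induct) (auto simp: eigenfuns_const intro!: eigenfuns_mult)

text \<open>Lagrange interpolation: each \<open>k\<close> outside the class of \<open>i\<close> is
  separated from \<open>i\<close> by some eigenvalue vector. A product of normalised separators is 1
  on the class and 0 elsewhere on \<open>I\<close>.\<close>

lemma class_indicator_eigenfun:
  assumes i: "i \<in> I"
  obtains e where "e \<in> eigenfuns" "\<And>j. j \<in> I \<Longrightarrow> e j = (if linked i j then 1 else 0)"
proof -
  define K where "K = {k\<in>I. \<not> linked i k}"
  have "finite K" using finite_index by (simp add: K_def)
  have "\<forall>k\<in>K. \<exists>l\<in>eigenfuns. l i \<noteq> l k" by (auto simp: K_def linked_def)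
  then obtain L where L: "\<And>k. k \<in> K \<Longrightarrow> L k \<in> eigenfuns" "\<And>k. k \<in> K \<Longrightarrow> L k i \<noteq> L k k"
    by metis
  \<comment> \<open>The affine normalisation gives value 1 at \<open>i\<close> and 0 at
    \<open>k\<close>; constants belong to the algebra, so \<open>f k\<close> stays inside
    it.\<close>
  define f where "f k j = (L k j + - L k k) * inverse (L k i - L k k)" for k j
  have f: "f k \<in> eigenfuns" if "k \<in> K" for k
    unfolding f_def using L(1)[OF that] by (intro eigenfuns_add eigenfuns_mult eigenfuns_const)
  have fi: "f k i = 1" "f k k = 0" if "k \<in> K" for k
    using L(2)[OF that] by (auto simp: f_def)
  define e where "e j = (\<Prod>k\<in>K. f k j)" for j
  show thesis
  proof
    show "e \<in> eigenfuns" unfolding e_def using eigenfuns_prod[OF \<open>finite K\<close> f] .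
    fix j assume j: "j \<in> I"
    show "e j = (if linked i j then 1 else 0)"
    proof (cases "linked i j")
      case True
      then have "f k j = 1" if "k \<in> K" for k
        using f[OF that] fi(1)[OF that] by (auto simp: linked_def)
      then show ?thesis using True by (simp add: e_def)
    next
      case False
      then have "j \<in> K" using j by (simp add: K_def)
      then show ?thesis using False fi(2) \<open>finite K\<close> by (auto simp: e_def prod_zero_iff)
    qed
  qed
qed

lemma linked_class_eq: "linked i j \<Longrightarrow> linked_class i = linked_class j"
  unfolding linked_class_def using linked_sym linked_trans by blast

lemma finite_linked_class: "finite (linked_class i)"
  using finite_index by (simp add: linked_class_def)

lemma card_linked_class: "i \<in> I \<Longrightarrow> real (card (linked_class i)) > 0"
  using finite_linked_class linked_refl by (auto simp: card_gt_0_iff linked_class_def)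

text \<open>Class indicators lie in the algebra, and every class-constant vector agrees on
  \<open>I\<close> with a linear combination of them.\<close>

lemma eigenfuns_iff: "l \<in> eigenfuns \<longleftrightarrow> class_constant l"
proof
  assume "l \<in> eigenfuns" then show "class_constant l"
    by (auto simp: class_constant_def linked_def)
next
  assume l: "class_constant l"
  have "\<forall>i\<in>I. \<exists>e\<in>eigenfuns. \<forall>j\<in>I. e j = (if linked i j then 1 else 0)"
    using class_indicator_eigenfun by metis
  then obtain e where e: "\<And>i. i \<in> I \<Longrightarrow> e i \<in> eigenfuns"
      "\<And>i j. i \<in> I \<Longrightarrow> j \<in> I \<Longrightarrow> e i j = (if linked i j then 1 else 0)" by metis
  \<comment> \<open>The sum runs over all indices rather than over classes, so each indicator occurs
    once per member of its class; dividing by the class size corrects for this.\<close>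
  have "(\<lambda>j. \<Sum>i\<in>I. (l i / real (card (linked_class i))) * e i j) \<in> eigenfuns"
    using e(1) by (intro eigenfuns_sum eigenfuns_mult eigenfuns_const finite_index)
  moreover have "(\<Sum>i\<in>I. (l i / real (card (linked_class i))) * e i j) = l j" if j: "j \<in> I" for j
  proof -
    have "(\<Sum>i\<in>I. (l i / real (card (linked_class i))) * e i j)
        = (\<Sum>i\<in>linked_class j. l j / real (card (linked_class j)))"
    proof (rule sum.mono_neutral_cong_right[OF finite_index])
      show "linked_class j \<subseteq> I" by (auto simp: linked_class_def)
      show "\<forall>i\<in>I - linked_class j. (l i / real (card (linked_class i))) * e i j = 0"
        using e(2) j linked_sym by (auto simp: linked_class_def)
      fix i assume "i \<in> linked_class j"
      then have i: "i \<in> I" "linked j i" by (auto simp: linked_class_def)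
      have eq: "l i = l j" using l i j unfolding class_constant_def by simp
      show "(l i / real (card (linked_class i))) * e i j = l j / real (card (linked_class j))"
        using e(2)[OF i(1) j] linked_sym[OF i(2)] linked_class_eq[OF i(2)] eq by simp
    qed
    then show ?thesis using card_linked_class[OF j] by simp
  qed
  ultimately show "l \<in> eigenfuns" by (rule eigenfuns_cong)
qed

section \<open>Class means as a projection onto class-constant vectors\<close>

lemma class_mean_constant: "class_constant (class_mean x)"
  by (auto simp: class_constant_def class_mean_def dest: linked_class_eq)

lemma class_mean_of_constant: "class_constant x \<Longrightarrow> i \<in> I \<Longrightarrow> class_mean x i = x i"
proof -
  assume x: "class_constant x" and i: "i \<in> I"
  have "(\<Sum>j\<in>linked_class i. x j) = (\<Sum>j\<in>linked_class i. x i)"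
    using x i by (intro sum.cong) (auto simp: class_constant_def linked_class_def)
  then show ?thesis using card_linked_class[OF i] by (simp add: class_mean_def)
qed

lemma class_mean_diff: "class_mean (\<lambda>i. x i - y i) i = class_mean x i - class_mean y i"
  by (simp add: class_mean_def sum_subtractf diff_divide_distrib)

lemma class_mean_add: "class_mean (\<lambda>i. x i + y i) i = class_mean x i + class_mean y i"
  by (simp add: class_mean_def sum.distrib add_divide_distrib)

lemma class_mean_residual: "i \<in> I \<Longrightarrow> class_mean (\<lambda>i. x i - class_mean x i) i = 0"
  by (simp add: class_mean_diff class_mean_of_constant class_mean_constant)

section \<open>Logarithmic scaling vectors of ray permutations\<close>

lemma invertible_of_monomial:
  fixes A :: "real ^ 'n ^ 'n"
  assumes \<sigma>: "\<sigma> permutes I" and A: "\<And>i. i \<in> I \<Longrightarrow> A *v v i = c i *\<^sub>R v (\<sigma> i)"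
    and c: "\<And>i. i \<in> I \<Longrightarrow> c i \<noteq> 0"
  shows "invertible A"
proof -
  have sub: "subspace (range ((*v) A))"
    by (intro linear_subspace_image matrix_vector_mul_linear subspace_UNIV)
  \<comment> \<open>Every generator is hit, up to a nonzero factor, by its preimage under
    \<open>\<sigma>\<close>; as generators span, \<open>A\<close> is surjective.\<close>
  have "v j \<in> range ((*v) A)" if "j \<in> I" for j
  proof -
    obtain i where i: "i \<in> I" "\<sigma> i = j"
      using \<sigma> \<open>j \<in> I\<close> by (metis permutes_image imageE)
    then have "A *v (inverse (c i) *\<^sub>R v i) = v j"
      using A c by (simp add: matrix_vector_mult_scaleR)
    then show ?thesis by (metis rangeI)
  qed
  then have "span (v ` I) \<subseteq> range ((*v) A)" using sub by (intro span_minimal) auto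
  then have "surj ((*v) A)" using spanning by auto
  then show ?thesis
    using matrix_right_invertible_surjective invertible_right_inverse by blast
qed

lemma acts_cong:
  "acts \<sigma> x \<Longrightarrow> (\<And>i. i \<in> I \<Longrightarrow> x i = y i) \<Longrightarrow> acts \<sigma> y"
  by (auto simp: acts_def)

lemma acts_compose:
  assumes "acts \<sigma> x" "acts \<tau> y" "\<tau> permutes I"
  shows "acts (\<sigma> \<circ> \<tau>) (\<lambda>i. x (\<tau> i) + y i)"
proof -
  from assms obtain A B :: "real ^ 'n ^ 'n" where
    "\<forall>i\<in>I. A *v v i = exp (x i) *\<^sub>R v (\<sigma> i)" "\<forall>i\<in>I. B *v v i = exp (y i) *\<^sub>R v (\<tau> i)"
    by (auto simp: acts_def)
  then have "\<forall>i\<in>I. (A ** B) *v v i = exp (x (\<tau> i) + y i) *\<^sub>R v ((\<sigma> \<circ> \<tau>) i)"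
    using permutes_in_image[OF assms(3)]
    by (simp add: matrix_vector_mul_assoc[symmetric] matrix_vector_mult_scaleR exp_add mult.commute)
  then show ?thesis unfolding acts_def by blast
qed

lemma acts_inverse:
  assumes "acts \<sigma> x" "\<sigma> permutes I"
  shows "acts (inv' \<sigma>) (\<lambda>i. - x (inv' \<sigma> i))"
proof -
  from assms obtain A :: "real ^ 'n ^ 'n" where
    A: "\<forall>i\<in>I. A *v v i = exp (x i) *\<^sub>R v (\<sigma> i)" by (auto simp: acts_def)
  then have "invertible A" using invertible_of_monomial[OF assms(2), of A "\<lambda>i. exp (x i)"] by auto
  then obtain B where B: "B ** A = mat 1" by (auto simp: invertible_def)
  have "B *v v i = exp (- x (inv' \<sigma> i)) *\<^sub>R v (inv' \<sigma> i)" if "i \<in> I" for i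
  proof -
    define j where "j = inv' \<sigma> i"
    have j: "j \<in> I" "\<sigma> j = i"
      using that assms(2) by (auto simp: j_def permutes_in_image[OF permutes_inv] permutes_inverses)
    have "v j = B *v (A *v v j)" by (simp add: matrix_vector_mul_assoc B)
    also have "\<dots> = exp (x j) *\<^sub>R (B *v v i)" using A j by (simp add: matrix_vector_mult_scaleR)
    finally show ?thesis by (simp add: j_def exp_minus)
  qed
  then show ?thesis unfolding acts_def by blast
qed

text \<open>The passage from multiplicative to additive: \<open>exp\<close> is injective, so taking
  logarithms of positive eigenvalues preserves and reflects constancy on classes.\<close>

lemma acts_id_iff: "acts id x \<longleftrightarrow> class_constant x"
proof -
  have "acts id x \<longleftrightarrow> (\<lambda>i. exp (x i)) \<in> eigenfuns" by (simp add: acts_def eigenfuns_def)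
  also have "\<dots> \<longleftrightarrow> class_constant x" unfolding eigenfuns_iff by (simp add: class_constant_def)
  finally show ?thesis .
qed

text \<open>Following one map by the inverse of the other fixes every ray. Together with
  \<open>acts_shift\<close> this shows that the scaling vectors of a ray permutation
  \<open>\<sigma>\<close> form a coset of the class-constant vectors.\<close>

lemma acts_diff:
  assumes "acts \<sigma> x" "acts \<sigma> y" "\<sigma> permutes I"
  shows "class_constant (\<lambda>i. x i - y i)"
proof -
  have "acts (inv' \<sigma> \<circ> \<sigma>) (\<lambda>i. - y (inv' \<sigma> (\<sigma> i)) + x i)"
    using acts_compose[OF acts_inverse[OF assms(2,3)] assms(1,3)] .
  then show ?thesis
    using assms(3) by (simp add: permutes_inv_o permutes_inverses acts_id_iff)
qed

lemma acts_shift: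
  assumes "acts \<sigma> x" "class_constant (\<lambda>i. y i - x i)"
  shows "acts \<sigma> y"
  using acts_compose[OF assms(1) assms(2)[folded acts_id_iff] permutes_id] by simp

section \<open>The finite group of ray permutations and its effect on classes\<close>

lemma proj_perms_permutes: "\<sigma> \<in> proj_perms \<Longrightarrow> \<sigma> permutes I"
  by (simp add: proj_perms_def)

lemma id_proj_perms: "id \<in> proj_perms"
  using acts_id_iff[of "\<lambda>_. 0"] permutes_id by (auto simp: proj_perms_def class_constant_def)

lemma proj_perms_compose: "\<sigma> \<in> proj_perms \<Longrightarrow> \<tau> \<in> proj_perms \<Longrightarrow> \<sigma> \<circ> \<tau> \<in> proj_perms"
  unfolding proj_perms_def using acts_compose permutes_compose by blast

lemma proj_perms_inv: "\<sigma> \<in> proj_perms \<Longrightarrow> inv' \<sigma> \<in> proj_perms"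
  unfolding proj_perms_def using acts_inverse permutes_inv by blast

lemma finite_proj_perms: "finite proj_perms"
  by (rule finite_subset[OF _ finite_permutations[OF finite_index]]) (auto simp: proj_perms_def)

text \<open>Conjugating a diagonal map \<open>D\<close> with eigenvalue vector \<open>l\<close> by a
  map inducing \<open>\<sigma>\<close> gives a diagonal map with eigenvalue vector \<open>l\<close>
  composed with \<open>\<sigma>\<close>, and linked indices cannot be told apart by the
  latter.\<close>

lemma linked_proj_perm:
  assumes "\<sigma> \<in> proj_perms" "i \<in> I" "j \<in> I" "linked i j"
  shows "linked (\<sigma> i) (\<sigma> j)"
  unfolding linked_def
proof
  fix l assume "l \<in> eigenfuns"
  then obtain D :: "real ^ 'n ^ 'n" where D: "\<forall>i\<in>I. D *v v i = l i *\<^sub>R v i"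
    by (auto simp: eigenfuns_def)
  from assms obtain x where x: "acts \<sigma> x" and \<sigma>: "\<sigma> permutes I" by (auto simp: proj_perms_def)
  obtain A B :: "real ^ 'n ^ 'n" where
    A: "\<forall>i\<in>I. A *v v i = exp (x i) *\<^sub>R v (\<sigma> i)" and
    B: "\<forall>i\<in>I. B *v v i = exp (- x (inv' \<sigma> i)) *\<^sub>R v (inv' \<sigma> i)"
    using x acts_inverse[OF x \<sigma>] by (auto simp: acts_def)
  have "\<forall>i\<in>I. (B ** (D ** A)) *v v i = l (\<sigma> i) *\<^sub>R v i"
    using A B D \<sigma>
    by (simp add: matrix_vector_mul_assoc[symmetric] matrix_vector_mult_scaleR permutes_in_image
        permutes_inverses exp_minus)
  then have "(\<lambda>i. l (\<sigma> i)) \<in> eigenfuns" unfolding eigenfuns_def by blast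
  then show "l (\<sigma> i) = l (\<sigma> j)" using assms(4) by (auto simp: linked_def)
qed

lemma linked_class_proj_perm:
  assumes "\<sigma> \<in> proj_perms" "i \<in> I"
  shows "linked_class (\<sigma> i) = \<sigma> ` linked_class i"
proof -
  have \<sigma>: "\<sigma> permutes I" using assms(1) by (rule proj_perms_permutes)
  show ?thesis
  proof
    show "\<sigma> ` linked_class i \<subseteq> linked_class (\<sigma> i)"
      using assms linked_proj_perm permutes_in_image[OF \<sigma>] by (auto simp: linked_class_def)
    show "linked_class (\<sigma> i) \<subseteq> \<sigma> ` linked_class i"
    proof
      fix k assume "k \<in> linked_class (\<sigma> i)"
      then have k: "k \<in> I" "linked (\<sigma> i) k" by (auto simp: linked_class_def)
      have "linked (inv' \<sigma> (\<sigma> i)) (inv' \<sigma> k)"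
        using linked_proj_perm[OF proj_perms_inv[OF assms(1)]] k assms(2) permutes_in_image[OF \<sigma>]
        by blast
      then have "inv' \<sigma> k \<in> linked_class i"
        using k permutes_in_image[OF permutes_inv[OF \<sigma>]] permutes_inverses[OF \<sigma>]
        by (auto simp: linked_class_def)
      then show "k \<in> \<sigma> ` linked_class i" using permutes_inverses(1)[OF \<sigma>] by (metis imageI)
    qed
  qed
qed

text \<open>Averaging is equivariant because \<open>\<sigma>\<close> carries the class of
  \<open>i\<close> bijectively onto the class of \<open>\<sigma> i\<close>.\<close>

lemma class_mean_proj_perm:
  assumes "\<sigma> \<in> proj_perms" "i \<in> I"
  shows "class_mean (\<lambda>j. x (\<sigma> j)) i = class_mean x (\<sigma> i)"
proof -
  have inj: "inj_on \<sigma> (linked_class i)"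
    using proj_perms_permutes[OF assms(1)] permutes_inj by (metis inj_on_subset subset_UNIV)
  show ?thesis
    unfolding class_mean_def linked_class_proj_perm[OF assms]
    by (simp add: sum.reindex[OF inj] card_image[OF inj] o_def)
qed

text \<open>The first cohomology of a finite group with real vector space coefficients vanishes.
  Here \<open>g\<close> is the logarithm of a rescaling of the generators that the whole group
  permutes.\<close>

lemma proj_perms_act_by_coboundary:
  obtains g where "\<And>\<sigma>. \<sigma> \<in> proj_perms \<Longrightarrow> acts \<sigma> (\<lambda>i. g (\<sigma> i) - g i)"
proof -
  have "\<forall>\<sigma>\<in>proj_perms. \<exists>x. acts \<sigma> x" by (auto simp: proj_perms_def)
  then obtain X where X: "\<And>\<sigma>. \<sigma> \<in> proj_perms \<Longrightarrow> acts \<sigma> (X \<sigma>)" by metis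
  \<comment> \<open>Each coset of scaling vectors contains exactly one vector, up to values off
    \<open>I\<close>, whose class means are all zero; this canonical choice turns composition up to
    class-constants into an exact identity.\<close>
  define n where "n \<sigma> i = X \<sigma> i - class_mean (X \<sigma>) i" for \<sigma> i
  have n_mean: "class_mean (n \<sigma>) i = 0" if "i \<in> I" for \<sigma> i
    unfolding n_def using class_mean_residual[OF that] .
  have n_acts: "acts \<sigma> (n \<sigma>)" if "\<sigma> \<in> proj_perms" for \<sigma>
  proof (rule acts_shift[OF X[OF that]])
    show "class_constant (\<lambda>i. n \<sigma> i - X \<sigma> i)"
      using class_mean_constant[of "X \<sigma>"] by (simp add: n_def class_constant_def)
  qed
  have cocycle: "n (\<sigma> \<circ> \<tau>) i = n \<sigma> (\<tau> i) + n \<tau> i"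
    if \<sigma>: "\<sigma> \<in> proj_perms" and \<tau>: "\<tau> \<in> proj_perms" and i: "i \<in> I" for \<sigma> \<tau> i
  proof -
    let ?d = "\<lambda>i. n (\<sigma> \<circ> \<tau>) i - (n \<sigma> (\<tau> i) + n \<tau> i)"
    have "acts (\<sigma> \<circ> \<tau>) (\<lambda>i. n \<sigma> (\<tau> i) + n \<tau> i)"
      using acts_compose[OF n_acts[OF \<sigma>] n_acts[OF \<tau>] proj_perms_permutes[OF \<tau>]] .
    then have "class_constant ?d"
      using acts_diff n_acts proj_perms_compose[OF \<sigma> \<tau>] proj_perms_permutes by blast
    \<comment> \<open>A class-constant vector equals its own class mean, and this mean is zero
      because every summand has zero mean, also after composition with
      \<open>\<tau>\<close>.\<close>
    then have "?d i = class_mean ?d i" using class_mean_of_constant i by metis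
    also have "\<dots> = 0"
      using i \<tau> proj_perms_permutes[OF \<tau>]
      by (simp add: class_mean_diff class_mean_add class_mean_proj_perm n_mean permutes_in_image)
    finally show ?thesis by simp
  qed
  define N where "N = real (card proj_perms)"
  have N: "N > 0" using finite_proj_perms id_proj_perms by (auto simp: N_def card_gt_0_iff)
  \<comment> \<open>The average, over the group, of the factor picked up on arriving at ray
    \<open>j\<close>.\<close>
  define g where "g j = (\<Sum>\<sigma>\<in>proj_perms. n \<sigma> (inv' \<sigma> j)) / N" for j
  show thesis
  proof
    fix \<tau> assume \<tau>: "\<tau> \<in> proj_perms"
    have \<tau>I: "\<tau> permutes I" using proj_perms_permutes[OF \<tau>] .
    \<comment> \<open>Left multiplication by \<open>\<tau>\<close> permutes the group, which allows
      the sum for \<open>g (\<tau> i)\<close> to be indexed by \<open>\<tau> \<circ> \<rho>\<close>;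
      the cocycle identity then splits off \<open>n \<tau> i\<close>.\<close>
    have bij: "bij_betw ((\<circ>) \<tau>) proj_perms proj_perms"
    proof (rule bij_betw_byWitness[where f' = "(\<circ>) (inv' \<tau>)"])
      show "\<forall>a\<in>proj_perms. inv' \<tau> \<circ> (\<tau> \<circ> a) = a" "\<forall>a\<in>proj_perms. \<tau> \<circ> (inv' \<tau> \<circ> a) = a"
        by (auto simp: fun_eq_iff permutes_inverses[OF \<tau>I])
    qed (use \<tau> proj_perms_compose proj_perms_inv in blast)+
    have "n \<tau> i = g (\<tau> i) - g i" if i: "i \<in> I" for i
    proof -
      have "(\<Sum>\<sigma>\<in>proj_perms. n \<sigma> (inv' \<sigma> (\<tau> i)))
          = (\<Sum>\<rho>\<in>proj_perms. n (\<tau> \<circ> \<rho>) (inv' (\<tau> \<circ> \<rho>) (\<tau> i)))"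
        using sum.reindex_bij_betw[OF bij, of "\<lambda>\<sigma>. n \<sigma> (inv' \<sigma> (\<tau> i))"] by simp
      also have "\<dots> = (\<Sum>\<rho>\<in>proj_perms. n \<tau> i + n \<rho> (inv' \<rho> i))"
      proof (rule sum.cong[OF refl])
        fix \<rho> assume \<rho>: "\<rho> \<in> proj_perms"
        have \<rho>I: "\<rho> permutes I" using proj_perms_permutes[OF \<rho>] .
        have "inv' (\<tau> \<circ> \<rho>) = inv' \<rho> \<circ> inv' \<tau>"
          using \<rho>I \<tau>I by (simp add: o_inv_distrib permutes_bij)
        then have "inv' (\<tau> \<circ> \<rho>) (\<tau> i) = inv' \<rho> i" using permutes_inverses[OF \<tau>I] by simp
        moreover have "inv' \<rho> i \<in> I" using i permutes_in_image[OF permutes_inv[OF \<rho>I]] by simp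
        ultimately show "n (\<tau> \<circ> \<rho>) (inv' (\<tau> \<circ> \<rho>) (\<tau> i)) = n \<tau> i + n \<rho> (inv' \<rho> i)"
          using cocycle[OF \<tau> \<rho>] permutes_inverses[OF \<rho>I] by simp
      qed
      also have "\<dots> = N * n \<tau> i + (\<Sum>\<rho>\<in>proj_perms. n \<rho> (inv' \<rho> i))"
        by (simp add: sum.distrib N_def)
      finally show ?thesis using N by (simp add: g_def field_simps)
    qed
    then show "acts \<tau> (\<lambda>i. g (\<tau> i) - g i)"
      by (intro acts_cong[OF n_acts[OF \<tau>]]) simp
  qed
qed

text \<open>Measured against the invariant rescaling \<open>g\<close>, the requirement is that the
  change of \<open>a - g\<close> under \<open>\<sigma>\<close> be class-constant. Removing class
  means from \<open>a - g\<close> turns this into exact invariance of one vector \<open>w\<close>,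
  the same for all \<open>\<sigma>\<close>.\<close>

lemma coboundary_action_is_stabilizer:
  obtains w :: "'i \<Rightarrow> real" where
    "\<And>\<sigma>. \<sigma> \<in> proj_perms \<Longrightarrow> acts \<sigma> (\<lambda>i. a (\<sigma> i) - a i) \<longleftrightarrow> (\<forall>i\<in>I. w (\<sigma> i) = w i)"
proof -
  obtain g where g: "\<And>\<sigma>. \<sigma> \<in> proj_perms \<Longrightarrow> acts \<sigma> (\<lambda>i. g (\<sigma> i) - g i)"
    using proj_perms_act_by_coboundary by blast
  define b where "b i = a i - g i" for i
  define w where "w i = b i - class_mean b i" for i
  show thesis
  proof
    fix \<sigma> assume \<sigma>: "\<sigma> \<in> proj_perms"
    have \<sigma>I: "\<sigma> permutes I" using proj_perms_permutes[OF \<sigma>] .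
    let ?b = "\<lambda>i. b (\<sigma> i) - b i" and ?w = "\<lambda>i. w (\<sigma> i) - w i"
    have eq: "(\<lambda>i. a (\<sigma> i) - a i - (g (\<sigma> i) - g i)) = ?b" by (auto simp: b_def)
    \<comment> \<open>By equivariance of averaging, \<open>?w\<close> is \<open>?b\<close> minus its
      own class mean, so it vanishes exactly when \<open>?b\<close> is class-constant.\<close>
    have wb: "?w i = ?b i - class_mean ?b i" if "i \<in> I" for i
      using that by (simp add: w_def class_mean_diff class_mean_proj_perm[OF \<sigma>])
    have "acts \<sigma> (\<lambda>i. a (\<sigma> i) - a i) \<longleftrightarrow> class_constant ?b"
      using acts_shift[OF g[OF \<sigma>], of "\<lambda>i. a (\<sigma> i) - a i"]
        acts_diff[OF _ g[OF \<sigma>] \<sigma>I, of "\<lambda>i. a (\<sigma> i) - a i"] unfolding eq by blast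
    also have "\<dots> \<longleftrightarrow> (\<forall>i\<in>I. ?w i = 0)"
    proof
      assume "class_constant ?b"
      then show "\<forall>i\<in>I. ?w i = 0" using class_mean_of_constant[of ?b] wb by simp
    next
      assume *: "\<forall>i\<in>I. ?w i = 0"
      then have "?b i = class_mean ?b i" if "i \<in> I" for i using wb[OF that] that by simp
      then show "class_constant ?b"
        using class_mean_constant[of ?b] by (simp add: class_constant_def)
    qed
    finally show "acts \<sigma> (\<lambda>i. a (\<sigma> i) - a i) \<longleftrightarrow> (\<forall>i\<in>I. w (\<sigma> i) = w i)" by simp
  qed
qed

end

section \<open>Extreme rays generate a pointed polyhedral cone\<close>

lemma ray_refl: "v \<in> ray v"
  unfolding ray_def by (metis (mono_tags, lifting) mem_Collect_eq scaleR_one zero_le_one)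

lemma ray_mem_iff: "x \<in> ray v \<longleftrightarrow> (\<exists>c\<ge>0. x = c *\<^sub>R v)"
  by (auto simp: ray_def)

lemma rayI: "0 \<le> c \<Longrightarrow> c *\<^sub>R v \<in> ray v"
  by (auto simp: ray_def)

lemma ray_scale:
  assumes "0 < c"
  shows "ray (c *\<^sub>R v) = ray v"
proof (intro equalityI subsetI)
  fix x assume "x \<in> ray (c *\<^sub>R v)"
  then obtain d where "d \<ge> 0" "x = (d * c) *\<^sub>R v" by (auto simp: ray_mem_iff)
  then show "x \<in> ray v" using assms by (simp add: rayI)
next
  fix x assume "x \<in> ray v"
  then obtain d where "d \<ge> 0" "x = (d / c) *\<^sub>R (c *\<^sub>R v)"
    using assms by (auto simp: ray_mem_iff)
  then show "x \<in> ray (c *\<^sub>R v)" using assms by (metis rayI divide_nonneg_pos)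
qed

lemma ray_image: "ray v = (\<lambda>c. c *\<^sub>R v) ` {0..}"
  by (auto simp: ray_def)

lemma matrix_image_ray:
  fixes A :: "real ^ 'n ^ 'm"
  shows "(*v) A ` ray v = ray (A *v v)"
  by (simp add: ray_image image_image matrix_vector_mult_scaleR)

lemma aff_dim_ray:
  fixes v :: "real ^ 'n"
  assumes "v \<noteq> 0"
  shows "aff_dim (ray v) = 1"
proof -
  have 0: "0 \<in> ray v" using rayI[of 0 v] by simp
  have "ray v \<subseteq> affine hull {0, v}"
    unfolding ray_def affine_hull_2_alt by auto
  then have "aff_dim (ray v) \<le> aff_dim {0, v}"
    using aff_dim_subset aff_dim_affine_hull by metis
  moreover have "aff_dim {0, v} \<le> aff_dim (ray v)"
    using 0 ray_refl by (intro aff_dim_subset) auto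
  ultimately show ?thesis using assms by simp
qed

lemma convex_ray: "convex (ray v)"
proof (rule convexI)
  fix x y a b assume xy: "x \<in> ray v" "y \<in> ray v" and ab: "0 \<le> a" "0 \<le> b" "a + b = (1 :: real)"
  obtain c d where "x = c *\<^sub>R v" "y = d *\<^sub>R v" "0 \<le> c" "0 \<le> d" using xy by (auto simp: ray_mem_iff)
  then show "a *\<^sub>R x + b *\<^sub>R y \<in> ray v" using ab by (simp add: rayI flip: scaleR_left_distrib)
qed

text \<open>A segment in the cone that crosses the ray of \<open>e\<close> can be rescaled to a
  segment in the slice through \<open>e\<close>, where extremality makes it degenerate.\<close>

lemma ray_of_base_extreme_point:
  fixes C :: "(real ^ 'n) set"
  assumes cone: "\<And>x t. x \<in> C \<Longrightarrow> 0 \<le> t \<Longrightarrow> t *\<^sub>R x \<in> C"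
    and pos: "\<And>x. x \<in> C \<Longrightarrow> x \<noteq> 0 \<Longrightarrow> 0 < c \<bullet> x"
    and e: "e extreme_point_of {x \<in> C. c \<bullet> x = 1}"
  shows "ray e \<in> extreme_rays C"
proof -
  have eC: "e \<in> C" "c \<bullet> e = 1" using e by (auto simp: extreme_point_of_def)
  have "e \<noteq> 0" using eC by auto
  have key: "a \<in> ray e \<and> b \<in> ray e"
    if a: "a \<in> C" and b: "b \<in> C" and u: "0 < u" "u < 1" and s: "0 \<le> s"
      and x: "(1 - u) *\<^sub>R a + u *\<^sub>R b = s *\<^sub>R e" for a b u s
  proof -
    have ray0: "0 \<in> ray e" using rayI[of 0 e] by simp
    \<comment> \<open>A zero endpoint cannot be rescaled into the slice, but then the other endpoint
      is visibly a nonnegative multiple of \<open>e\<close>.\<close>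
    consider "a = 0" | "b = 0" | "a \<noteq> 0" "b \<noteq> 0" by blast
    then show ?thesis
    proof cases
      case 1
      then have "b = inverse u *\<^sub>R (s *\<^sub>R e)" using u by (simp flip: x)
      then show ?thesis using 1 ray0 u s by (simp add: rayI)
    next
      case 2
      then have "a = inverse (1 - u) *\<^sub>R (s *\<^sub>R e)" using u by (simp flip: x)
      then show ?thesis using 2 ray0 u s by (simp add: rayI)
    next
      case 3
      define \<alpha> \<beta> where "\<alpha> = c \<bullet> a" and "\<beta> = c \<bullet> b"
      have ab: "\<alpha> > 0" "\<beta> > 0" using pos a b 3 by (auto simp: \<alpha>_def \<beta>_def)
      define a' b' where "a' = inverse \<alpha> *\<^sub>R a" and "b' = inverse \<beta> *\<^sub>R b"
      have B: "a' \<in> {x \<in> C. c \<bullet> x = 1}" "b' \<in> {x \<in> C. c \<bullet> x = 1}"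
        using ab a b cone by (auto simp: a'_def b'_def \<alpha>_def \<beta>_def)
      have "c \<bullet> ((1 - u) *\<^sub>R a + u *\<^sub>R b) = s" using x eC by simp
      then have s_eq: "(1 - u) * \<alpha> + u * \<beta> = s" by (simp add: \<alpha>_def \<beta>_def inner_right_distrib)
      have upos: "u * \<beta> > 0" "(1 - u) * \<alpha> > 0" using u ab by auto
      then have spos: "s > 0" using s_eq by linarith
      \<comment> \<open>Rescaling the endpoints to \<open>c\<close>-value 1 changes the weight
        \<open>u\<close> into \<open>t\<close>; the denominator \<open>s\<close> is the
        \<open>c\<close>-value of the crossing point.\<close>
      define t where "t = u * \<beta> / s"
      have t: "0 < t" "t < 1" using upos spos s_eq by (auto simp: t_def)
      have t': "1 - t = (1 - u) * \<alpha> / s" using spos s_eq by (simp add: t_def field_simps)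
      have "(1 - t) *\<^sub>R a' + t *\<^sub>R b' = inverse s *\<^sub>R ((1 - u) *\<^sub>R a + u *\<^sub>R b)"
      proof -
        have "(1 - t) * inverse \<alpha> = inverse s * (1 - u)" "t * inverse \<beta> = inverse s * u"
          unfolding t' using ab by (simp_all add: t_def divide_inverse)
        then show ?thesis by (simp add: a'_def b'_def scaleR_right_distrib)
      qed
      also have "\<dots> = e" using x spos by simp
      finally have e_eq: "e = (1 - t) *\<^sub>R a' + t *\<^sub>R b'" by simp
      have "a' = b'"
      proof (rule ccontr)
        assume "a' \<noteq> b'"
        then have "e \<in> open_segment a' b'" using e_eq t by (auto simp: in_segment)
        then show False using e B by (auto simp: extreme_point_of_def)
      qed
      then have "a' = e" "b' = e" using e_eq by (auto simp flip: scaleR_left_distrib)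
      moreover have "a = \<alpha> *\<^sub>R a'" "b = \<beta> *\<^sub>R b'" using ab by (auto simp: a'_def b'_def)
      ultimately show ?thesis using ab by (metis rayI less_imp_le)
    qed
  qed
  have "ray e face_of C"
    unfolding face_of_def
  proof (intro conjI ballI impI)
    show "ray e \<subseteq> C" using cone eC by (auto simp: ray_mem_iff)
    show "convex (ray e)" by (rule convex_ray)
    fix a b x assume "a \<in> C" "b \<in> C" "x \<in> ray e" "x \<in> open_segment a b"
    then obtain u s where "0 < u" "u < 1" "0 \<le> s" "(1 - u) *\<^sub>R a + u *\<^sub>R b = s *\<^sub>R e"
      by (auto simp: in_segment ray_mem_iff)
    with key \<open>a \<in> C\<close> \<open>b \<in> C\<close> show "a \<in> ray e" "b \<in> ray e" by blast+
  qed
  then show ?thesis using aff_dim_ray[OF \<open>e \<noteq> 0\<close>] by (simp add: extreme_rays_def)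
qed

text \<open>The sum of the constraint normals works: if all constraints vanished at a nonzero
  \<open>x\<close>, the line through \<open>x\<close> would lie in the cone.\<close>

lemma pointed_polyhedral_cone_positive_functional:
  fixes C :: "(real ^ 'n) set"
  assumes "polyhedral_cone C" "pointed C"
  obtains c where "\<And>x. x \<in> C \<Longrightarrow> x \<noteq> 0 \<Longrightarrow> 0 < c \<bullet> x"
proof -
  from assms obtain F where F: "finite F" "C = {x. \<forall>a\<in>F. 0 \<le> a \<bullet> x}"
    by (auto simp: polyhedral_cone_def)
  show thesis
  proof
    fix x assume x: "x \<in> C" "x \<noteq> 0"
    have "\<exists>a\<in>F. a \<bullet> x \<noteq> 0"
    proof (rule ccontr)
      assume "\<not> ?thesis"
      then have "span {x} \<subseteq> C" by (auto simp: span_singleton F)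
      then have "span {x} = {0}" using assms(2) by (auto simp: pointed_def)
      then show False using x(2) span_superset[of "{x}"] by blast
    qed
    then obtain a where "a \<in> F" "0 < a \<bullet> x" using F x by (auto simp: less_le)
    then have "0 < (\<Sum>a\<in>F. a \<bullet> x)"
      using F x by (intro sum_pos2[of F a]) auto
    then show "0 < (\<Sum>a\<in>F. a) \<bullet> x" by (simp add: inner_sum_left)
  qed
qed

lemma polyhedral_cone_closed_convex:
  assumes "polyhedral_cone C"
  shows "closed C" "convex C" "\<And>x t. x \<in> C \<Longrightarrow> 0 \<le> t \<Longrightarrow> t *\<^sub>R x \<in> C"
proof -
  from assms obtain F where "C = {x. \<forall>a\<in>F. 0 \<le> a \<bullet> x}" by (auto simp: polyhedral_cone_def)
  then have C: "C = (\<Inter>a\<in>F. {x. a \<bullet> x \<ge> 0})" by auto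
  show "closed C" unfolding C by (intro closed_INT ballI closed_halfspace_ge)
  show "convex C" unfolding C by (intro convex_INT convex_halfspace_ge)
  show "\<And>x t. x \<in> C \<Longrightarrow> 0 \<le> t \<Longrightarrow> t *\<^sub>R x \<in> C" unfolding C by auto
qed

text \<open>The slice on which a positive functional equals 1 is compact and convex, hence the hull
  of its extreme points, and these span extreme rays. The origin is excluded because the cone
  \<open>{0}\<close> has no extreme rays.\<close>

lemma pointed_cone_generated_by_extreme_rays:
  fixes C :: "(real ^ 'n) set"
  assumes C: "polyhedral_cone C" "pointed C" and x: "x \<in> C" "x \<noteq> 0"
  shows "x \<in> convex hull (\<Union> (extreme_rays C))"
proof -
  note closed = polyhedral_cone_closed_convex(1)[OF C(1)]
    and convex = polyhedral_cone_closed_convex(2)[OF C(1)]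
    and cone = polyhedral_cone_closed_convex(3)[OF C(1)]
  obtain c where pos: "\<And>x. x \<in> C \<Longrightarrow> x \<noteq> 0 \<Longrightarrow> 0 < c \<bullet> x"
    using pointed_polyhedral_cone_positive_functional[OF C] by blast
  define B where "B = {x \<in> C. c \<bullet> x = 1}"
  have B_Int: "B = C \<inter> {x. c \<bullet> x = 1}" by (auto simp: B_def)
  have "bounded B"
  proof -
    \<comment> \<open>By compactness the functional has a positive minimum over unit vectors of the
      cone; its inverse bounds the norm on the slice.\<close>
    let ?S = "C \<inter> sphere 0 1"
    have "compact ?S" using closed by (intro closed_Int_compact) auto
    moreover have "inverse (norm x) *\<^sub>R x \<in> ?S" using x cone[OF x(1)] by simp
    then have "?S \<noteq> {}" by blast
    ultimately obtain m where m: "m \<in> ?S" "\<And>y. y \<in> ?S \<Longrightarrow> c \<bullet> m \<le> c \<bullet> y"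
      using continuous_attains_inf[of ?S "\<lambda>y. c \<bullet> y"]
        continuous_on_inner[OF continuous_on_const continuous_on_id, of ?S c] by blast
    have "0 < c \<bullet> m" using m(1) pos by force
    have "norm y \<le> inverse (c \<bullet> m)" if "y \<in> B" for y
    proof -
      have y: "y \<in> C" "c \<bullet> y = 1" using that by (auto simp: B_def)
      then have "y \<noteq> 0" by auto
      then have "inverse (norm y) *\<^sub>R y \<in> ?S" using y cone[OF y(1)] by simp
      then have "c \<bullet> m \<le> inverse (norm y)" using m(2) y(2) by fastforce
      then show ?thesis using \<open>0 < c \<bullet> m\<close> \<open>y \<noteq> 0\<close> by (simp add: field_simps)
    qed
    then show ?thesis by (auto simp: bounded_iff)
  qed
  moreover have "closed B" unfolding B_Int by (intro closed_Int closed closed_hyperplane)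
  ultimately have "compact B" by (simp add: compact_eq_bounded_closed)
  moreover have "convex B" unfolding B_Int by (intro convex_Int convex convex_hyperplane)
  ultimately have KM: "B = convex hull {e. e extreme_point_of B}" by (rule Krein_Milman_Minkowski)
  define t where "t = c \<bullet> x"
  have t: "t > 0" using pos x by (simp add: t_def)
  have "inverse t *\<^sub>R x \<in> B" using t cone[OF x(1)] by (simp add: B_def t_def)
  then have "t *\<^sub>R (inverse t *\<^sub>R x) \<in> (*\<^sub>R) t ` (convex hull {e. e extreme_point_of B})"
    using KM by blast
  then have "x \<in> convex hull ((*\<^sub>R) t ` {e. e extreme_point_of B})"
    using t by (simp add: convex_hull_scaling)
  moreover have "(*\<^sub>R) t ` {e. e extreme_point_of B} \<subseteq> \<Union> (extreme_rays C)"
  proof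
    fix y assume "y \<in> (*\<^sub>R) t ` {e. e extreme_point_of B}"
    then obtain e where e: "e extreme_point_of B" "y = t *\<^sub>R e" by blast
    then have "y \<in> ray e" using t by (simp add: rayI)
    moreover have "ray e \<in> extreme_rays C"
      using ray_of_base_extreme_point[OF cone pos] e(1) unfolding B_def by blast
    ultimately show "y \<in> \<Union> (extreme_rays C)" by blast
  qed
  ultimately show ?thesis using hull_mono by blast
qed

text \<open>The cone lies in the span of its extreme rays, while full dimension makes its affine
  hull the whole space.\<close>

lemma extreme_rays_spanning:
  fixes C :: "(real ^ 'n) set"
  assumes "polyhedral_cone C" "full_dimensional C" "pointed C"
  shows "span (\<Union> (extreme_rays C)) = UNIV"
proof -
  have "C \<subseteq> span (\<Union> (extreme_rays C))"
    using pointed_cone_generated_by_extreme_rays[OF assms(1,3)] convex_hull_subset_span span_zero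
    by blast
  then have "span C \<subseteq> span (\<Union> (extreme_rays C))" by (intro span_minimal) auto
  moreover have "affine hull C = UNIV"
    using assms(2) aff_dim_eq_full[of C] by (simp add: full_dimensional_def)
  ultimately show ?thesis using affine_hull_subset_span[of C] by blast
qed

text \<open>The cone is recovered from its rays by convexity. Applying this to a map and to its
  inverse upgrades a permutation of rays to a symmetry of the cone.\<close>

lemma matrix_image_cone_subset:
  fixes A :: "real ^ 'n ^ 'n"
  assumes "polyhedral_cone C" "pointed C"
    and rays: "\<And>R. R \<in> extreme_rays C \<Longrightarrow> (*v) A ` R \<in> extreme_rays C"
  shows "(*v) A ` C \<subseteq> C"
proof -
  have sub: "R \<subseteq> C" if "R \<in> extreme_rays C" for R
    using that by (auto simp: extreme_rays_def dest: face_of_imp_subset)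
  have "A *v x \<in> C" if x: "x \<in> C" for x
  proof (cases "x = 0")
    case True
    then show ?thesis using x by simp
  next
    case False
    have "A *v x \<in> (*v) A ` (convex hull (\<Union> (extreme_rays C)))"
      using pointed_cone_generated_by_extreme_rays[OF assms(1,2) x False] by blast
    also have "\<dots> = convex hull ((*v) A ` \<Union> (extreme_rays C))"
      by (intro convex_hull_linear_image matrix_vector_mul_linear)
    also have "\<dots> \<subseteq> C"
    proof (rule hull_minimal)
      show "(*v) A ` \<Union> (extreme_rays C) \<subseteq> C" using rays sub by blast
      show "convex C" using polyhedral_cone_closed_convex(2)[OF assms(1)] .
    qed
    finally show ?thesis .
  qed
  then show ?thesis by blast
qed

section \<open>The symmetry groups as stabilisers\<close>

locale cone_with_generators =
  fixes C :: "(real ^ 'n) set" and v :: "nat \<Rightarrow> real ^ 'n" and p :: nat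
  assumes polyhedral: "polyhedral_cone C" and full_dim: "full_dimensional C"
    and pointed: "pointed C"
    and rays: "bij_betw (\<lambda>i. ray (v i)) {1..p} (extreme_rays C)"
begin

lemma extreme_rays_eq: "extreme_rays C = (\<lambda>i. ray (v i)) ` {1..p}"
  using rays by (simp add: bij_betw_def)

lemma generator_nonzero: "i \<in> {1..p} \<Longrightarrow> v i \<noteq> 0"
proof
  assume "i \<in> {1..p}" "v i = 0"
  then have "ray 0 \<in> extreme_rays C" using extreme_rays_eq by (metis imageI)
  moreover have "ray (0 :: real ^ 'n) = {0}" by (auto simp: ray_mem_iff)
  ultimately show False by (simp add: extreme_rays_def)
qed

sublocale spanning_family "{1..p}" v
proof
  have "\<Union> (extreme_rays C) \<subseteq> span (v ` {1..p})"
    unfolding extreme_rays_eq ray_def by (auto intro: span_scale[OF span_base])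
  then have "span (\<Union> (extreme_rays C)) \<subseteq> span (v ` {1..p})" by (intro span_minimal) auto
  then show "span (v ` {1..p}) = UNIV"
    using extreme_rays_spanning[OF polyhedral full_dim pointed] by blast
qed simp

text \<open>Mapping rays onto rays amounts to scaling generators by positive factors, and
  preservation of the cone follows from permuting its extreme rays.\<close>

lemma carrier_proj_group: "carrier (proj_group p C (\<lambda>i. ray (v i))) = proj_perms"
proof (intro equalityI subsetI)
  fix \<sigma> assume "\<sigma> \<in> carrier (proj_group p C (\<lambda>i. ray (v i)))"
  then obtain A :: "real ^ 'n ^ 'n" where \<sigma>: "\<sigma> permutes {1..p}" and "invertible A"
    and A: "\<And>i. i \<in> {1..p} \<Longrightarrow> (*v) A ` ray (v i) = ray (v (\<sigma> i))"
    by (auto simp: proj_group_def sym_group_carrier)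
  then obtain B where B: "B ** A = mat 1" by (auto simp: invertible_def)
  have "\<exists>c>0. A *v v i = c *\<^sub>R v (\<sigma> i)" if i: "i \<in> {1..p}" for i
  proof -
    have "A *v v i \<in> ray (v (\<sigma> i))" using A[OF i] ray_refl by blast
    then obtain c where c: "c \<ge> 0" "A *v v i = c *\<^sub>R v (\<sigma> i)" by (auto simp: ray_mem_iff)
    \<comment> \<open>Membership in a ray gives only a nonnegative factor; injectivity of
      \<open>A\<close> makes it positive, so that its logarithm makes sense.\<close>
    have "A *v v i \<noteq> 0"
    proof
      assume "A *v v i = 0"
      then have "B *v (A *v v i) = 0" by simp
      then show False using generator_nonzero[OF i] by (simp add: matrix_vector_mul_assoc B)
    qed
    then have "c \<noteq> 0" using c by auto
    then show ?thesis using c by (metis order_le_imp_less_or_eq)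
  qed
  then obtain c where c: "\<And>i. i \<in> {1..p} \<Longrightarrow> c i > 0 \<and> A *v v i = c i *\<^sub>R v (\<sigma> i)" by metis
  then have "\<forall>i\<in>{1..p}. A *v v i = exp (ln (c i)) *\<^sub>R v (\<sigma> i)" by (metis exp_ln)
  then have "acts \<sigma> (\<lambda>i. ln (c i))" unfolding acts_def by blast
  then show "\<sigma> \<in> proj_perms" using \<sigma> unfolding proj_perms_def by blast
next
  fix \<sigma> assume "\<sigma> \<in> proj_perms"
  then obtain x and A :: "real ^ 'n ^ 'n" where \<sigma>: "\<sigma> permutes {1..p}"
    and A: "\<And>i. i \<in> {1..p} \<Longrightarrow> A *v v i = exp (x i) *\<^sub>R v (\<sigma> i)"
    unfolding proj_perms_def acts_def by blast
  have inv: "invertible A" using invertible_of_monomial[OF \<sigma> A] by simp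
  then obtain B where B: "A ** B = mat 1" "B ** A = mat 1" by (auto simp: invertible_def)
  have ray: "(*v) A ` ray (v i) = ray (v (\<sigma> i))" if "i \<in> {1..p}" for i
    using A[OF that] by (simp add: matrix_image_ray ray_scale)
  have BA: "(*v) B ` (*v) A ` S = S" and AB: "(*v) A ` (*v) B ` S = S" for S
    by (simp_all add: image_image matrix_vector_mul_assoc B)
  have "(*v) A ` C \<subseteq> C"
  proof (rule matrix_image_cone_subset[OF polyhedral pointed])
    show "(*v) A ` R \<in> extreme_rays C" if "R \<in> extreme_rays C" for R
      using that ray permutes_index[OF \<sigma>] unfolding extreme_rays_eq by blast
  qed
  \<comment> \<open>The inverse permutes the extreme rays as well; this yields the inclusion of the
    cone in its image under \<open>A\<close>.\<close>
  moreover have "(*v) B ` C \<subseteq> C"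
  proof (rule matrix_image_cone_subset[OF polyhedral pointed])
    fix R assume "R \<in> extreme_rays C"
    then obtain j where j: "j \<in> {1..p}" "R = ray (v j)" by (auto simp: extreme_rays_eq)
    then obtain i where "i \<in> {1..p}" "\<sigma> i = j" using \<sigma> by (metis permutes_image imageE)
    then have "(*v) B ` R = ray (v i)" using BA ray j by metis
    then show "(*v) B ` R \<in> extreme_rays C" using \<open>i \<in> {1..p}\<close> by (simp add: extreme_rays_eq)
  qed
  then have "(*v) A ` (*v) B ` C \<subseteq> (*v) A ` C" by (rule image_mono)
  ultimately have "(*v) A ` C = C" unfolding AB by blast
  with inv ray have "\<exists>A :: real ^ 'n ^ 'n. invertible A \<and> (*v) A ` C = C \<and>
      (\<forall>i\<in>{1..p}. (*v) A ` ray (v i) = ray (v (\<sigma> i)))" by blast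
  then show "\<sigma> \<in> carrier (proj_group p C (\<lambda>i. ray (v i)))"
    using \<sigma> by (simp add: proj_group_def sym_group_carrier)
qed

text \<open>Sending \<open>\<alpha> i *\<^sub>R v i\<close> to its counterpart at
  \<open>\<sigma> i\<close> fixes the factor on \<open>v i\<close> as
  \<open>\<alpha> (\<sigma> i) / \<alpha> i\<close>, whose logarithm is the coboundary of
  \<open>ln \<alpha>\<close>.\<close>

lemma carrier_lin_group:
  assumes \<alpha>: "\<And>i. i \<in> {1..p} \<Longrightarrow> 0 < \<alpha> i"
  shows "carrier (lin_group p (scaled \<alpha> v))
    = {\<sigma> \<in> proj_perms. acts \<sigma> (\<lambda>i. ln (\<alpha> (\<sigma> i)) - ln (\<alpha> i))}"
proof -
  have eq: "A *v scaled \<alpha> v i = scaled \<alpha> v (\<sigma> i) \<longleftrightarrow>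
      A *v v i = exp (ln (\<alpha> (\<sigma> i)) - ln (\<alpha> i)) *\<^sub>R v (\<sigma> i)"
    if \<sigma>: "\<sigma> permutes {1..p}" and i: "i \<in> {1..p}" for A :: "real ^ 'n ^ 'n" and \<sigma> i
  proof -
    have p: "0 < \<alpha> i" "0 < \<alpha> (\<sigma> i)" using \<alpha> i permutes_index[OF \<sigma> i] by auto
    have "\<alpha> i *\<^sub>R (A *v v i) = \<alpha> i *\<^sub>R ((\<alpha> (\<sigma> i) / \<alpha> i) *\<^sub>R v (\<sigma> i)) \<longleftrightarrow>
        A *v v i = (\<alpha> (\<sigma> i) / \<alpha> i) *\<^sub>R v (\<sigma> i)"
      using p(1) by (subst scaleR_cancel_left) simp
    then show ?thesis using p by (simp add: scaled_def matrix_vector_mult_scaleR exp_diff)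
  qed
  have "(\<exists>A :: real ^ 'n ^ 'n. invertible A \<and>
        (\<forall>i\<in>{1..p}. A *v scaled \<alpha> v i = scaled \<alpha> v (\<sigma> i))) \<longleftrightarrow>
      acts \<sigma> (\<lambda>i. ln (\<alpha> (\<sigma> i)) - ln (\<alpha> i))" if \<sigma>: "\<sigma> permutes {1..p}" for \<sigma>
  proof
    assume "\<exists>A :: real ^ 'n ^ 'n. invertible A \<and>
        (\<forall>i\<in>{1..p}. A *v scaled \<alpha> v i = scaled \<alpha> v (\<sigma> i))"
    then show "acts \<sigma> (\<lambda>i. ln (\<alpha> (\<sigma> i)) - ln (\<alpha> i))"
      unfolding acts_def using eq[OF \<sigma>] by blast
  next
    assume "acts \<sigma> (\<lambda>i. ln (\<alpha> (\<sigma> i)) - ln (\<alpha> i))"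
    then obtain A :: "real ^ 'n ^ 'n" where
      A: "\<And>i. i \<in> {1..p} \<Longrightarrow> A *v v i = exp (ln (\<alpha> (\<sigma> i)) - ln (\<alpha> i)) *\<^sub>R v (\<sigma> i)"
      unfolding acts_def by blast
    then have "invertible A" using invertible_of_monomial[OF \<sigma> A] by simp
    then show "\<exists>A :: real ^ 'n ^ 'n. invertible A \<and>
        (\<forall>i\<in>{1..p}. A *v scaled \<alpha> v i = scaled \<alpha> v (\<sigma> i))"
      using A eq[OF \<sigma>] by blast
  qed
  then show ?thesis
    unfolding lin_group_def proj_perms_def sym_group_carrier by auto
qed

lemma lin_group_is_stabilizer:
  assumes "\<And>i. i \<in> {1..p} \<Longrightarrow> 0 < \<alpha> i"
  obtains w :: "nat \<Rightarrow> real" where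
    "carrier (lin_group p (scaled \<alpha> v)) = {\<sigma> \<in> proj_perms. \<forall>i\<in>{1..p}. w (\<sigma> i) = w i}"
proof -
  obtain w :: "nat \<Rightarrow> real" where "\<And>\<sigma>. \<sigma> \<in> proj_perms \<Longrightarrow>
      acts \<sigma> (\<lambda>i. ln (\<alpha> (\<sigma> i)) - ln (\<alpha> i)) \<longleftrightarrow> (\<forall>i\<in>{1..p}. w (\<sigma> i) = w i)"
    using coboundary_action_is_stabilizer[of "\<lambda>i. ln (\<alpha> i)"] by blast
  then show thesis using carrier_lin_group[of \<alpha>, OF assms] by (intro that[of w]) auto
qed

text \<open>The vector \<open>w\<close> defining the group of \<open>\<beta>\<close> is constant on
  the orbits of that group. An element of the group of \<open>\<alpha>\<close> moves indices only
  within these same orbits, so it preserves \<open>w\<close>.\<close>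

lemma lin_group_subset_if_partition_eq:
  assumes \<alpha>: "\<And>i. i \<in> {1..p} \<Longrightarrow> 0 < \<alpha> i" and \<beta>: "\<And>i. i \<in> {1..p} \<Longrightarrow> 0 < \<beta> i"
    and part: "orbit_partition p (lin_group p (scaled \<alpha> v))
      = orbit_partition p (lin_group p (scaled \<beta> v))"
  shows "carrier (lin_group p (scaled \<alpha> v)) \<subseteq> carrier (lin_group p (scaled \<beta> v))"
proof
  let ?G = "lin_group p (scaled \<alpha> v)" and ?H = "lin_group p (scaled \<beta> v)"
  fix \<sigma> assume \<sigma>: "\<sigma> \<in> carrier ?G"
  obtain w :: "nat \<Rightarrow> real" where
    w: "carrier ?H = {\<sigma> \<in> proj_perms. \<forall>i\<in>{1..p}. w (\<sigma> i) = w i}"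
    using lin_group_is_stabilizer[of \<beta>, OF \<beta>] by blast
  have "w (\<sigma> i) = w i" if i: "i \<in> {1..p}" for i
  proof -
    have "orbit ?G (\<lambda>\<sigma>. \<sigma>) i \<in> orbit_partition p ?H"
      using i part by (auto simp: orbit_partition_def orbits_def)
    then obtain k where k: "k \<in> {1..p}" "orbit ?G (\<lambda>\<sigma>. \<sigma>) i = orbit ?H (\<lambda>\<sigma>. \<sigma>) k"
      by (auto simp: orbit_partition_def orbits_def)
    \<comment> \<open>The identity places \<open>i\<close> itself in the shared orbit, so that both
      \<open>i\<close> and \<open>\<sigma> i\<close> are reached from \<open>k\<close> by elements
      preserving \<open>w\<close>.\<close>
    have "id \<in> carrier ?G"
      using group.is_monoid[OF group_lin_group, THEN monoid.one_closed, of p "scaled \<alpha> v"]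
      by (simp add: lin_group_def sym_group_def)
    then have "id i \<in> orbit ?G (\<lambda>\<sigma>. \<sigma>) i" unfolding orbit_def by blast
    then have "i \<in> orbit ?H (\<lambda>\<sigma>. \<sigma>) k" unfolding k(2) by simp
    then obtain \<tau> where \<tau>: "\<tau> \<in> carrier ?H" "\<tau> k = i" by (auto simp: orbit_def)
    have "\<sigma> i \<in> orbit ?G (\<lambda>\<sigma>. \<sigma>) i" using \<sigma> unfolding orbit_def by blast
    then have "\<sigma> i \<in> orbit ?H (\<lambda>\<sigma>. \<sigma>) k" unfolding k(2) .
    then obtain \<rho> where \<rho>: "\<rho> \<in> carrier ?H" "\<rho> k = \<sigma> i" by (auto simp: orbit_def)
    have "w (\<tau> k) = w k" "w (\<rho> k) = w k" using \<tau>(1) \<rho>(1) k(1) unfolding w by blast+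
    then show ?thesis using \<tau> \<rho> by simp
  qed
  moreover have "\<sigma> \<in> proj_perms" using \<sigma> carrier_lin_group[of \<alpha>, OF \<alpha>] by simp
  ultimately show "\<sigma> \<in> carrier ?H" unfolding w by blast
qed

text \<open>Transitivity forces the stabilised vector \<open>w\<close> to be constant, and every ray
  permutation preserves a constant vector.\<close>

lemma transitive_lin_group_eq_proj_perms:
  assumes \<alpha>: "\<And>i. i \<in> {1..p} \<Longrightarrow> 0 < \<alpha> i"
    and trans: "transitive_on_indices p (lin_group p (scaled \<alpha> v))"
  shows "carrier (lin_group p (scaled \<alpha> v)) = proj_perms"
proof -
  obtain w :: "nat \<Rightarrow> real" where
    w: "carrier (lin_group p (scaled \<alpha> v)) = {\<sigma> \<in> proj_perms. \<forall>i\<in>{1..p}. w (\<sigma> i) = w i}"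
    using lin_group_is_stabilizer[of \<alpha>, OF \<alpha>] by blast
  have "w j = w i" if ij: "i \<in> {1..p}" "j \<in> {1..p}" for i j
  proof -
    obtain \<sigma> where "\<sigma> \<in> carrier (lin_group p (scaled \<alpha> v))" "\<sigma> i = j"
      using trans ij unfolding transitive_on_indices_def by blast
    then show ?thesis using ij unfolding w by blast
  qed
  then show ?thesis unfolding w using permutes_index[OF proj_perms_permutes] by blast
qed

end

theorem theorem10:
  fixes C :: "(real ^ 'n) set" and v :: "nat \<Rightarrow> real ^ 'n" and p :: nat
  assumes "polyhedral_cone C" and "full_dimensional C" and "pointed C"
    and "bij_betw (\<lambda>i. ray (v i)) {1..p} (extreme_rays C)"
  shows "(\<forall>\<alpha> \<alpha>'. (\<forall>i\<in>{1..p}. 0 < \<alpha> i) \<and> (\<forall>i\<in>{1..p}. 0 < \<alpha>' i) \<and>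
            orbit_partition p (lin_group p (scaled \<alpha> v)) = orbit_partition p (lin_group p (scaled \<alpha>' v))
            \<longrightarrow> lin_group p (scaled \<alpha> v) = lin_group p (scaled \<alpha>' v))
       \<and> (\<forall>\<alpha>. (\<forall>i\<in>{1..p}. 0 < \<alpha> i) \<and> transitive_on_indices p (lin_group p (scaled \<alpha> v))
            \<longrightarrow> lin_group p (scaled \<alpha> v) = proj_group p C (\<lambda>i. ray (v i)))"
proof (intro conjI allI impI; elim conjE)
  interpret cone_with_generators C v p using assms by unfold_locales
  \<comment> \<open>The groups are records that differ at most in their carriers.\<close>
  have lin_eqI: "lin_group p u = lin_group p u'"
    if "carrier (lin_group p u) = carrier (lin_group p u')" for u u' :: "nat \<Rightarrow> real ^ 'n"
    using that by (simp add: lin_group_def)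
  show "lin_group p (scaled \<alpha> v) = lin_group p (scaled \<alpha>' v)"
    if "\<forall>i\<in>{1..p}. 0 < \<alpha> i" "\<forall>i\<in>{1..p}. 0 < \<alpha>' i"
      "orbit_partition p (lin_group p (scaled \<alpha> v)) = orbit_partition p (lin_group p (scaled \<alpha>' v))"
    for \<alpha> \<alpha>'
    using that lin_group_subset_if_partition_eq[of \<alpha> \<alpha>'] lin_group_subset_if_partition_eq[of \<alpha>' \<alpha>]
    by (intro lin_eqI subset_antisym) simp_all
  show "lin_group p (scaled \<alpha> v) = proj_group p C (\<lambda>i. ray (v i))"
    if "\<forall>i\<in>{1..p}. 0 < \<alpha> i" "transitive_on_indices p (lin_group p (scaled \<alpha> v))" for \<alpha>
  proof -
    have "carrier (lin_group p (scaled \<alpha> v)) = carrier (proj_group p C (\<lambda>i. ray (v i)))"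
      using transitive_lin_group_eq_proj_perms[of \<alpha>] carrier_proj_group that by simp
    then show ?thesis by (simp add: lin_group_def proj_group_def)
  qed
qed

end
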